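(* Let $\mathbb{F}$ be any field, let $n_1,n_2>2$ and let $T\in\mathbb{F}^{n_1}\otimes\mathbb{F}^{n_2}\otimes\mathbb{F}^2$ be concise. Then $Q(T)=2$.
   Context: $T$ is concise if each of its three flattenings $T_i\in\mathbb{F}^{n_i}\otimes(\mathbb{F}^{n_j}\otimes\mathbb{F}^{n_k})$ (as $n_i\times n_jn_k$ matrices, with $n_3=2$) has rank $n_i$. The subrank $Q(T)$ is the largest $r$ such that there are linear maps $L_i$ with $(L_1\otimes L_2\otimes L_3)T=\sum_{i=1}^re_i\otimes e_i\otimes e_i$. *)

theory Defs
  imports "Jordan_Normal_Form.DL_Rank"
begin

(* A tensor in F^n1 (x) F^n2 (x) F^n3 is given by its coordinates T i j k in the standard bases,
   with i < n1, j < n2, k < n3. The dimensions are passed separately, and no notion below looks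
   at the values of T outside this box. *)
type_synonym 'a tensor3 = "nat \<Rightarrow> nat \<Rightarrow> nat \<Rightarrow> 'a"

(* The columns of a flattening are indexed by pairs (c div n, c mod n). *)
definition flattening1 :: "nat \<Rightarrow> nat \<Rightarrow> nat \<Rightarrow> 'a tensor3 \<Rightarrow> 'a mat" where
  "flattening1 n1 n2 n3 T = mat n1 (n2 * n3) (\<lambda>(i, c). T i (c div n3) (c mod n3))"

definition flattening2 :: "nat \<Rightarrow> nat \<Rightarrow> nat \<Rightarrow> 'a tensor3 \<Rightarrow> 'a mat" where
  "flattening2 n1 n2 n3 T = mat n2 (n1 * n3) (\<lambda>(j, c). T (c div n3) j (c mod n3))"

definition flattening3 :: "nat \<Rightarrow> nat \<Rightarrow> nat \<Rightarrow> 'a tensor3 \<Rightarrow> 'a mat" where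
  "flattening3 n1 n2 n3 T = mat n3 (n1 * n2) (\<lambda>(k, c). T (c div n2) (c mod n2) k)"

definition concise :: "nat \<Rightarrow> nat \<Rightarrow> nat \<Rightarrow> 'a::field tensor3 \<Rightarrow> bool" where
  "concise n1 n2 n3 T \<longleftrightarrow>
     vec_space.rank n1 (flattening1 n1 n2 n3 T) = n1 \<and>
     vec_space.rank n2 (flattening2 n1 n2 n3 T) = n2 \<and>
     vec_space.rank n3 (flattening3 n1 n2 n3 T) = n3"

(* Coordinates of (L1 (x) L2 (x) L3) T, each Li being given by its matrix Ai. *)
definition tensor_apply :: "'a::field mat \<Rightarrow> 'a mat \<Rightarrow> 'a mat \<Rightarrow> 'a tensor3 \<Rightarrow> 'a tensor3" where
  "tensor_apply A1 A2 A3 T = (\<lambda>a b c.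
     \<Sum>i<dim_col A1. \<Sum>j<dim_col A2. \<Sum>k<dim_col A3.
       A1 $$ (a, i) * A2 $$ (b, j) * A3 $$ (c, k) * T i j k)"

(* The sum over l < r of e_l (x) e_l (x) e_l in F^r (x) F^r (x) F^r. *)
definition unit_tensor :: "nat \<Rightarrow> 'a::field tensor3" where
  "unit_tensor r = (\<lambda>a b c. \<Sum>l<r. unit_vec r l $ a * unit_vec r l $ b * unit_vec r l $ c)"

definition restricts_to_unit :: "nat \<Rightarrow> nat \<Rightarrow> nat \<Rightarrow> 'a::field tensor3 \<Rightarrow> nat \<Rightarrow> bool" where
  "restricts_to_unit n1 n2 n3 T r \<longleftrightarrow>
     (\<exists>A1 \<in> carrier_mat r n1. \<exists>A2 \<in> carrier_mat r n2. \<exists>A3 \<in> carrier_mat r n3.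
        \<forall>a<r. \<forall>b<r. \<forall>c<r. tensor_apply A1 A2 A3 T a b c = unit_tensor r a b c)"

definition subrank :: "nat \<Rightarrow> nat \<Rightarrow> nat \<Rightarrow> 'a::field tensor3 \<Rightarrow> nat" where
  "subrank n1 n2 n3 T = (GREATEST r. restricts_to_unit n1 n2 n3 T r)"

(* The greatest r in the definition of the subrank exists. *)

lemma unit_tensor_entry:
  assumes "a < r" "b < r" "c < r"
  shows "unit_tensor r a b c = (if a = b \<and> b = c then 1 else 0 :: 'a::field)"
proof -
  have "unit_tensor r a b c =
      (\<Sum>l<r. if l = a then (if a = b \<and> b = c then 1 else 0 :: 'a) else 0)"
    unfolding unit_tensor_def using assms by (intro sum.cong) (auto simp: unit_vec_def)
  also have "\<dots> = (if a = b \<and> b = c then 1 else 0)"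
    using assms by (subst sum.delta) auto
  finally show ?thesis .
qed

lemma restricts_to_unit_0: "restricts_to_unit n1 n2 n3 T 0"
  unfolding restricts_to_unit_def
  by (intro bexI[of _ "0\<^sub>m 0 n1"] bexI[of _ "0\<^sub>m 0 n2"] bexI[of _ "0\<^sub>m 0 n3"]) auto

lemma restricts_to_unit_le:
  fixes T :: "'a::field tensor3"
  assumes "restricts_to_unit n1 n2 n3 T r"
  shows "r \<le> n1"
proof (rule ccontr)
  assume "\<not> r \<le> n1"
  then have less: "n1 < r" by simp
  obtain A1 A2 A3 where A: "A1 \<in> carrier_mat r n1" "A2 \<in> carrier_mat r n2" "A3 \<in> carrier_mat r n3"
    and eq: "\<And>a b c. a < r \<Longrightarrow> b < r \<Longrightarrow> c < r \<Longrightarrow>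
      tensor_apply A1 A2 A3 T a b c = unit_tensor r a b c"
    using assms unfolding restricts_to_unit_def by blast
  define B where "B i b = (\<Sum>j<n2. \<Sum>k<n3. A2 $$ (b, j) * A3 $$ (b, k) * T i j k)" for i b
  define P where "P = mat r r (\<lambda>(a, i). if i < n1 then A1 $$ (a, i) else 0)"
  define Q where "Q = mat r r (\<lambda>(i, b). if i < n1 then B i b else 0)"
  have "(P * Q) $$ (a, b) = (1\<^sub>m r :: 'a mat) $$ (a, b)" if "a < r" "b < r" for a b
  proof -
    have "(P * Q) $$ (a, b) = (\<Sum>i<r. if i < n1 then A1 $$ (a, i) * B i b else 0)"
      using that unfolding P_def Q_def
      by (auto simp: scalar_prod_def atLeast0LessThan intro!: sum.cong)
    also have "\<dots> = (\<Sum>i<n1. A1 $$ (a, i) * B i b)"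
      using less by (intro sum.mono_neutral_cong_right) auto
    also have "\<dots> = tensor_apply A1 A2 A3 T a b b"
      using A unfolding tensor_apply_def B_def
      by (simp add: sum_distrib_left mult.assoc)
    also have "\<dots> = (1\<^sub>m r :: 'a mat) $$ (a, b)"
      using eq[of a b b] that by (simp add: unit_tensor_entry)
    finally show ?thesis .
  qed
  then have "P * Q = 1\<^sub>m r"
    by (intro eq_matI) (auto simp: P_def Q_def)
  then have "Q * P = 1\<^sub>m r"
    using mat_mult_left_right_inverse[of P r Q] by (simp add: P_def Q_def)
  moreover have "(Q * P) $$ (n1, n1) = 0"
    using less unfolding P_def Q_def by (simp add: scalar_prod_def)
  ultimately show False using less by simp
qed

lemma restricts_to_unit_subrank: "restricts_to_unit n1 n2 n3 T (subrank n1 n2 n3 T)"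
  unfolding subrank_def
  by (rule GreatestI_nat[of _ 0 n1]) (auto intro: restricts_to_unit_0 restricts_to_unit_le)

lemma le_subrank: "restricts_to_unit n1 n2 n3 T r \<Longrightarrow> r \<le> subrank n1 n2 n3 T"
  unfolding subrank_def
  by (rule Greatest_le_nat[of _ _ n1]) (auto intro: restricts_to_unit_le)

end

theory Submission
  imports Defs
begin

text \<open>
  Let \<open>\<beta> : F^n1 \<times> F^n2 \<rightarrow> F^2\<close> be the bilinear map with coordinates \<open>T\<close>. Subrank at least 2 means that
  there are \<open>u1, u2, v1, v2\<close> with \<open>\<beta>(u1, v2) = \<beta>(u2, v1) = 0\<close> and \<open>\<beta>(u1, v1)\<close>, \<open>\<beta>(u2, v2)\<close>
  independent. It suffices to find \<open>u, v, u', v'\<close> with \<open>\<beta>(u, v) = 0\<close> and \<open>\<beta>(u, v')\<close>, \<open>\<beta>(u', v)\<close>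
  independent, because \<open>u'\<close> and \<open>v'\<close> can be corrected by multiples of \<open>u\<close> and \<open>v\<close> so that also
  \<open>\<beta>(u', v') = 0\<close>. If there are none, consider any \<open>u\<close>. Since \<open>n2 > 2\<close>, some \<open>k \<noteq> 0\<close> has
  \<open>\<beta>(u, k) = 0\<close>, and conciseness gives \<open>u'\<close> with \<open>\<beta>(u', k) \<noteq> 0\<close>; so \<open>\<beta>(u, _)\<close> stays in the line
  of \<open>\<beta>(u', k)\<close>. By symmetry each \<open>\<beta>(_, v)\<close> stays in a line. If \<open>\<beta>(u, v)\<close> and \<open>\<beta>(u', v')\<close> are
  independent, then \<open>\<beta>(u, v')\<close> is parallel to both, hence zero, and \<open>u, v', u', v\<close> are as wanted.
\<close>

section \<open>Full row rank and left kernels\<close>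

text \<open>A maximal independent set of columns has \<open>n\<close> elements, hence is a basis,
  and a vector orthogonal to a basis is orthogonal to every unit vector.\<close>

lemma full_row_rank_left_kernel:
  fixes A :: "'a::field mat"
  assumes A: "A \<in> carrier_mat n m" and rank: "vec_space.rank n A = n"
    and x: "x \<in> carrier_vec n" and orth: "\<And>c. c < m \<Longrightarrow> x \<bullet> col A c = 0"
  shows "x = 0\<^sub>v n"
proof -
  interpret vec_space "TYPE('a)" n .
  have cols: "set (cols A) \<subseteq> carrier_vec n" using A cols_dim by blast
  obtain S where S: "maximal S (\<lambda>T. T \<subseteq> set (cols A) \<and> lin_indpt T)"
    using maximal_exists_superset[of "set (cols A)" "\<lambda>T. T \<subseteq> set (cols A) \<and> lin_indpt T" "{}"]
    by (auto simp: lin_dep_def)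
  then have sub: "S \<subseteq> set (cols A)" and li: "lin_indpt S" by (auto simp: maximal_def)
  have "card S = n" using rank_card_indpt[OF A S] rank by simp
  then have "basis S"
    using dim_li_is_basis[of S] sub cols li dim_is_n finite_subset[OF sub] by auto
  then have span: "span S = carrier_vec n" by (simp add: basis_def)
  have "x \<bullet> y = 0" if "y \<in> set (cols A)" for y
    using that orth A by (auto simp: in_set_conv_nth)
  then have "x \<in> orthogonal_complement S"
    using x sub by (auto simp: orthogonal_complement_def)
  then have "x \<in> orthogonal_complement (carrier_vec n)"
    using in_orthogonal_complement_span[of S] span sub cols by auto
  then have "x \<bullet> unit_vec n i = 0" for i
    by (auto simp: orthogonal_complement_def)
  then show ?thesis using x by (intro eq_vecI) (auto simp flip: scalar_prod_right_unit)
qed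

lemma mat_left_kernel:
  fixes f :: "nat \<times> nat \<Rightarrow> 'a::field"
  assumes "vec_space.rank n (mat n m f) = n"
    and "\<And>c. c < m \<Longrightarrow> (\<Sum>i<n. x i * f (i, c)) = 0" and "i < n"
  shows "x i = 0"
proof -
  have "vec n x = 0\<^sub>v n"
    using assms(2)
    by (intro full_row_rank_left_kernel[OF _ assms(1)])
       (auto simp: scalar_prod_def atLeast0LessThan)
  then show ?thesis using \<open>i < n\<close> by (metis index_vec index_zero_vec(1))
qed

section \<open>The bilinear map of a tensor\<close>

definition contract :: "nat \<Rightarrow> nat \<Rightarrow> 'a::field tensor3 \<Rightarrow> (nat \<Rightarrow> 'a) \<Rightarrow> (nat \<Rightarrow> 'a) \<Rightarrow> nat \<Rightarrow> 'a" where
  "contract m n T u v k = (\<Sum>i<m. \<Sum>j<n. u i * v j * T i j k)"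

text \<open>Carries statements about one argument of \<open>contract\<close> over to the
  other.\<close>

definition transpose_tensor :: "'a tensor3 \<Rightarrow> 'a tensor3" where
  "transpose_tensor T j i k = T i j k"

lemma contract_transpose: "contract n m (transpose_tensor T) v u = contract m n T u v"
  unfolding contract_def transpose_tensor_def
  by (subst sum.swap) (simp add: mult.commute)

lemma contract_add_left:
  "contract m n T (\<lambda>i. u i + a * w i) v k = contract m n T u v k + a * contract m n T w v k"
  unfolding contract_def by (simp add: distrib_right sum.distrib sum_distrib_left mult.assoc)

lemma contract_add_right:
  "contract m n T u (\<lambda>j. v j + a * w j) k = contract m n T u v k + a * contract m n T u w k"
  using contract_add_left[of n m "transpose_tensor T"] by (simp add: contract_transpose)

lemma contract_unit_left:
  "a < m \<Longrightarrow> contract m n T (\<lambda>i. if i = a then 1 else 0) v k = (\<Sum>j<n. v j * T a j k)"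
proof -
  assume a: "a < m"
  have "contract m n T (\<lambda>i. if i = a then 1 else 0) v k =
      (\<Sum>i<m. if i = a then (\<Sum>j<n. v j * T a j k) else 0)"
    unfolding contract_def by (intro sum.cong) auto
  then show ?thesis using a by simp
qed

lemma contract_unit_unit:
  assumes "a < m" "b < n"
  shows "contract m n T (\<lambda>i. if i = a then 1 else 0) (\<lambda>j. if j = b then 1 else 0) k = T a b k"
proof -
  have "(\<Sum>j<n. (if j = b then 1 else 0) * T a j k) = (\<Sum>j<n. if j = b then T a b k else 0)"
    by (intro sum.cong) auto
  then show ?thesis using assms by (simp add: contract_unit_left)
qed

section \<open>Parallel vectors in the plane\<close>

text \<open>The 2 by 2 determinant, zero exactly when \<open>(p 0, p 1)\<close> and
  \<open>(q 0, q 1)\<close> are linearly dependent.\<close>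

definition cross :: "(nat \<Rightarrow> 'a::field) \<Rightarrow> (nat \<Rightarrow> 'a) \<Rightarrow> 'a" where
  "cross p q = p 0 * q 1 - p 1 * q 0"

lemma cross_trans:
  assumes "cross p r = 0" "cross q r = 0" "r 0 \<noteq> 0 \<or> r 1 \<noteq> 0"
  shows "cross p q = 0"
proof -
  have "r 0 * cross p q = q 0 * cross p r - p 0 * cross q r"
    "r 1 * cross p q = q 1 * cross p r - p 1 * cross q r"
    by (simp_all add: cross_def algebra_simps)
  then show ?thesis using assms by auto
qed

text \<open>The minors \<open>cross q r\<close>, \<open>cross r p\<close>, \<open>cross p q\<close>
  are coefficients of a relation; if all of them vanish, \<open>p\<close> and \<open>q\<close> alone
  are already dependent.\<close>

lemma three_vectors_dependent:
  fixes p q r :: "nat \<Rightarrow> 'a::field"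
  obtains x y z where "x \<noteq> 0 \<or> y \<noteq> 0 \<or> z \<noteq> 0"
    "x * p 0 + y * q 0 + z * r 0 = 0" "x * p 1 + y * q 1 + z * r 1 = 0"
proof -
  consider "cross q r \<noteq> 0 \<or> cross r p \<noteq> 0 \<or> cross p q \<noteq> 0" | "cross p q = 0" "p 0 \<noteq> 0"
    | "cross p q = 0" "p 1 \<noteq> 0" | "p 0 = 0" "p 1 = 0" by blast
  then show thesis
  proof cases
    case 1
    show thesis
      by (rule that[OF 1]) (simp_all add: cross_def algebra_simps)
  next
    case 2
    then show thesis by (intro that[of "q 0" "- p 0" 0]) (auto simp: cross_def)
  next
    case 3
    then show thesis by (intro that[of "q 1" "- p 1" 0]) (auto simp: cross_def mult.commute)
  next
    case 4
    then show thesis by (intro that[of 1 0 0]) auto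
  qed
qed

lemma contract_kernel:
  fixes T :: "'a::field tensor3"
  assumes "n > 2"
  obtains k j where "j < n" "k j \<noteq> 0" "contract m n T u k 0 = 0" "contract m n T u k 1 = 0"
proof -
  define w :: "nat \<Rightarrow> nat \<Rightarrow> 'a" where "w a = (\<lambda>j. if j = a then 1 else 0)" for a
  define p where "p a = contract m n T u (w a)" for a
  obtain x y z where nz: "x \<noteq> 0 \<or> y \<noteq> 0 \<or> z \<noteq> 0"
    and eq: "x * p 0 0 + y * p 1 0 + z * p 2 0 = 0" "x * p 0 1 + y * p 1 1 + z * p 2 1 = 0"
    using three_vectors_dependent[of "p 0" "p 1" "p 2"] by blast
  \<comment> \<open>The leading \<open>0\<close> lets \<open>contract_add_right\<close> apply three
    times, down to the contraction with the zero vector.\<close>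
  define k where "k j = (((0 + x * w 0 j) + y * w 1 j) + z * w 2 j)" for j
  have "contract m n T u k c = x * p 0 c + y * p 1 c + z * p 2 c" for c
    unfolding k_def contract_add_right p_def by (simp add: contract_def)
  moreover have "k 0 = x" "k 1 = y" "k 2 = z" by (simp_all add: k_def w_def)
  ultimately show thesis
    using nz eq assms that[of 0 k] that[of 1 k] that[of 2 k] by fastforce
qed

section \<open>Reaching the unit tensor of size two\<close>

lemma restricts_to_unit_2I:
  fixes T :: "'a::field tensor3"
  assumes zero: "contract m n T u1 v2 0 = 0" "contract m n T u1 v2 1 = 0"
    "contract m n T u2 v1 0 = 0" "contract m n T u2 v1 1 = 0"
    and indep: "cross (contract m n T u1 v1) (contract m n T u2 v2) \<noteq> 0"
  shows "restricts_to_unit m n 2 T 2"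
proof -
  define p q where "p = contract m n T u1 v1" and "q = contract m n T u2 v2"
  define u v where "u a = (if a = (0::nat) then u1 else u2)"
    and "v a = (if a = (0::nat) then v1 else v2)" for a
  define A1 where "A1 = mat 2 m (\<lambda>(a, i). u a i)"
  define A2 where "A2 = mat 2 n (\<lambda>(b, j). v b j)"
  \<comment> \<open>The inverse, by the adjugate formula, of the matrix with columns
    \<open>p\<close> and \<open>q\<close>: it sends them to the two unit vectors.\<close>
  define A3 where "A3 = mat 2 2 (\<lambda>(c, k). (if c = 0 then if k = 0 then q 1 else - q 0
      else if k = 0 then - p 1 else p 0) / cross p q)"
  have apply_eq: "tensor_apply A1 A2 A3 T a b c =
      A3 $$ (c, 0) * contract m n T (u a) (v b) 0 + A3 $$ (c, 1) * contract m n T (u a) (v b) 1"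
    if "a < 2" "b < 2" for a b c
  proof -
    have entries: "A1 $$ (a, i) = u a i" "A2 $$ (b, j) = v b j" if "i < m" "j < n" for i j
      using that \<open>a < 2\<close> \<open>b < 2\<close> by (simp_all add: A1_def A2_def)
    have dims: "dim_col A1 = m" "dim_col A2 = n" "dim_col A3 = 2"
      by (simp_all add: A1_def A2_def A3_def)
    show ?thesis
      unfolding tensor_apply_def contract_def dims sum_distrib_left sum.distrib[symmetric]
      by (intro sum.cong refl) (simp add: entries numeral_2_eq_2 mult_ac)
  qed
  have nz: "cross p q \<noteq> 0" using indep by (simp add: p_def q_def)
  have diag: "contract m n T (u 0) (v 0) = p" "contract m n T (u 1) (v 1) = q"
    by (simp_all add: u_def v_def p_def q_def)
  have off: "contract m n T (u 0) (v 1) k = 0" "contract m n T (u 1) (v 0) k = 0" if "k \<in> {0, 1}" for k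
    using that zero by (auto simp: u_def v_def)
  have A3: "A3 $$ (0, 0) = q 1 / cross p q" "A3 $$ (0, 1) = - q 0 / cross p q"
    "A3 $$ (1, 0) = - p 1 / cross p q" "A3 $$ (1, 1) = p 0 / cross p q"
    by (simp_all add: A3_def)
  have inverse: "q 1 / cross p q * p 0 + - q 0 / cross p q * p 1 = 1"
    "- p 1 / cross p q * q 0 + p 0 / cross p q * q 1 = 1"
    "q 1 / cross p q * q 0 + - q 0 / cross p q * q 1 = 0"
    "- p 1 / cross p q * p 0 + p 0 / cross p q * p 1 = 0"
    using nz by (simp_all add: field_simps) (simp_all add: cross_def algebra_simps)
  have "tensor_apply A1 A2 A3 T a b c = unit_tensor 2 a b c" if "a < 2" "b < 2" "c < 2" for a b c
  proof -
    have "a \<in> {0, 1}" "b \<in> {0, 1}" "c \<in> {0, 1}" using that by auto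
    then show ?thesis
      unfolding apply_eq[OF that(1,2)] unit_tensor_entry[OF that]
      by (elim insertE emptyE; simp only: diag off A3 inverse insert_iff) simp_all
  qed
  then show ?thesis
    unfolding restricts_to_unit_def
    by (intro bexI[of _ A1] bexI[of _ A2] bexI[of _ A3]) (auto simp: A1_def A2_def A3_def)
qed

lemma restricts_to_unit_2_of_zero:
  fixes T :: "'a::field tensor3"
  assumes zero: "contract m n T u v 0 = 0" "contract m n T u v 1 = 0"
    and indep: "cross (contract m n T u v') (contract m n T u' v) \<noteq> 0"
  shows "restricts_to_unit m n 2 T 2"
proof -
  define z y w where "z = contract m n T u v'" and "y = contract m n T u' v"
    and "w = contract m n T u' v'"
  have d: "cross z y \<noteq> 0" using indep by (simp add: z_def y_def)
  \<comment> \<open>Cramer's rule for \<open>w + \<gamma> z + \<sigma> y = 0\<close>.\<close>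
  define \<gamma> \<sigma> where "\<gamma> = - cross w y / cross z y" and "\<sigma> = - cross z w / cross z y"
  have "w 0 * cross z y - cross w y * z 0 - cross z w * y 0 = 0"
    "w 1 * cross z y - cross w y * z 1 - cross z w * y 1 = 0"
    by (simp_all add: cross_def algebra_simps)
  then have corr: "w 0 + \<gamma> * z 0 + \<sigma> * y 0 = 0" "w 1 + \<gamma> * z 1 + \<sigma> * y 1 = 0"
    using d unfolding \<gamma>_def \<sigma>_def by (simp_all add: field_simps)
  \<comment> \<open>Expanding the contraction of \<open>u2\<close> and \<open>v1\<close> gives the
    left-hand sides of \<open>corr\<close>, since the term with \<open>\<gamma> * \<sigma>\<close>
    carries the vanishing contraction of \<open>u\<close> and \<open>v\<close>.\<close>
  define u2 v1 where "u2 = (\<lambda>i. u' i + \<gamma> * u i)" and "v1 = (\<lambda>j. v' j + \<sigma> * v j)"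
  have "contract m n T u v1 k = z k" "contract m n T u2 v k = y k"
    "contract m n T u2 v1 k = w k + \<gamma> * z k + \<sigma> * y k" if "k \<in> {0, 1}" for k
    using that zero
    by (auto simp: u2_def v1_def contract_add_left contract_add_right z_def y_def w_def)
  then show ?thesis
    using zero corr d by (intro restricts_to_unit_2I[of m n T u v u2 v1]) (auto simp: cross_def)
qed

text \<open>Nondegeneracy in the second argument enters as a hypothesis, so that the lemma applies
  both to \<open>T\<close> and to its transpose.\<close>

lemma contract_parallel:
  fixes T :: "'a::field tensor3"
  assumes "n > 2"
    and nondeg: "\<And>k. (\<And>i c. i < m \<Longrightarrow> c < 2 \<Longrightarrow> (\<Sum>j<n. k j * T i j c) = 0) \<Longrightarrow> \<forall>j<n. k j = 0"
    and no_unit: "\<And>u v u' v'. contract m n T u v 0 = 0 \<Longrightarrow> contract m n T u v 1 = 0 \<Longrightarrow>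
      cross (contract m n T u v') (contract m n T u' v) = 0"
  shows "cross (contract m n T u v) (contract m n T u v') = 0"
proof -
  obtain k j where k: "j < n" "k j \<noteq> 0" "contract m n T u k 0 = 0" "contract m n T u k 1 = 0"
    using contract_kernel[OF \<open>n > 2\<close>, of m T u] .
  then obtain i c where ic: "i < m" "c < 2" "(\<Sum>j<n. k j * T i j c) \<noteq> 0"
    using nondeg[of k] by blast
  \<comment> \<open>This vector spans the line: by \<open>no_unit\<close> at \<open>u\<close> and
    \<open>k\<close>, every contraction of \<open>u\<close> is parallel to it.\<close>
  define r where "r = contract m n T (\<lambda>i'. if i' = i then 1 else 0) k"
  have "r c \<noteq> 0" using ic by (simp add: r_def contract_unit_left)
  then have "r 0 \<noteq> 0 \<or> r 1 \<noteq> 0" using \<open>c < 2\<close> by (auto simp: less_2_cases_iff)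
  then show ?thesis
    using cross_trans[of _ r] no_unit[OF k(3,4)] unfolding r_def by blast
qed

section \<open>Consequences of conciseness\<close>

lemma concise_nonzero_minor:
  fixes T :: "'a::field tensor3"
  assumes "vec_space.rank 2 (flattening3 n1 n2 2 T) = 2"
  obtains i j i' j' where "i < n1" "j < n2" "i' < n1" "j' < n2" "cross (T i j) (T i' j') \<noteq> 0"
proof (rule ccontr)
  note nonzero = that
  assume "\<not> thesis"
  have minors: "cross (T i j) (T i' j') = 0" if "i < n1" "j < n2" "i' < n1" "j' < n2"
    for i j i' j' using that \<open>\<not> thesis\<close> nonzero by blast
  have ker: "x k = 0"
    if "\<And>i j. i < n1 \<Longrightarrow> j < n2 \<Longrightarrow> x 0 * T i j 0 + x 1 * T i j 1 = 0" "k < 2" for x :: "nat \<Rightarrow> 'a" and k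
  proof (rule mat_left_kernel[OF assms[unfolded flattening3_def] _ \<open>k < 2\<close>])
    fix c assume c: "c < n1 * n2"
    then have "n2 > 0" by (cases n2) auto
    with c have "c div n2 < n1" "c mod n2 < n2" by (auto simp: less_mult_imp_div_less)
    then show "(\<Sum>i<2. x i * (case (i, c) of (k, c) \<Rightarrow> T (c div n2) (c mod n2) k)) = 0"
      using that(1) by (simp add: numeral_2_eq_2)
  qed
  have T0: "T i j k = 0" if "i < n1" "j < n2" "k < 2" for i j k
  proof -
    \<comment> \<open>This \<open>x\<close> is orthogonal to the vector \<open>T i j\<close>. The
      vanishing minors make it orthogonal to all the others, so it lies in the left kernel of the
      third flattening.\<close>
    have "x k = 0" if "k < 2" "x = (\<lambda>k. if k = 0 then T i j 1 else - T i j 0)" for k :: nat and x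
      using ker[OF _ that(1), of x] minors[OF \<open>i < n1\<close> \<open>j < n2\<close>] that(2)
      by (simp add: cross_def algebra_simps)
    from this[of 0] this[of 1] show ?thesis using \<open>k < 2\<close> by (auto simp: less_2_cases_iff)
  qed
  \<comment> \<open>With all entries of \<open>T\<close> zero, even a nonzero constant vector lies
    in that left kernel.\<close>
  then show False using ker[of "\<lambda>_. 1" 0] by simp
qed

lemma concise_nondegenerate1:
  fixes T :: "'a::field tensor3"
  assumes "vec_space.rank n1 (flattening1 n1 n2 n3 T) = n1"
    and "\<And>j c. j < n2 \<Longrightarrow> c < n3 \<Longrightarrow> (\<Sum>i<n1. k i * T i j c) = 0"
  shows "\<forall>i<n1. k i = 0"
proof (intro allI impI)
  fix i assume "i < n1"
  show "k i = 0"
  proof (rule mat_left_kernel[OF assms(1)[unfolded flattening1_def] _ \<open>i < n1\<close>])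
    fix c assume c: "c < n2 * n3"
    then have "n3 > 0" by (cases n3) auto
    with c have "c div n3 < n2" "c mod n3 < n3" by (auto simp: less_mult_imp_div_less)
    then show "(\<Sum>i<n1. k i * (case (i, c) of (i, c) \<Rightarrow> T i (c div n3) (c mod n3))) = 0"
      using assms(2) by simp
  qed
qed

lemma concise_nondegenerate2:
  fixes T :: "'a::field tensor3"
  assumes "vec_space.rank n2 (flattening2 n1 n2 n3 T) = n2"
    and "\<And>i c. i < n1 \<Longrightarrow> c < n3 \<Longrightarrow> (\<Sum>j<n2. k j * T i j c) = 0"
  shows "\<forall>j<n2. k j = 0"
  using concise_nondegenerate1[of n2 n1 n3 "transpose_tensor T" k] assms
  by (simp add: flattening1_def flattening2_def transpose_tensor_def)

section \<open>Upper and lower bound for the subrank\<close>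

text \<open>The unit tensor is symmetric, so reversing the three factors turns the bound by the
  first dimension into one by the third.\<close>

lemma restricts_to_unit_le3:
  fixes T :: "'a::field tensor3"
  assumes "restricts_to_unit n1 n2 n3 T r"
  shows "r \<le> n3"
proof -
  obtain A1 A2 A3 where A: "A1 \<in> carrier_mat r n1" "A2 \<in> carrier_mat r n2" "A3 \<in> carrier_mat r n3"
    and eq: "\<And>a b c. a < r \<Longrightarrow> b < r \<Longrightarrow> c < r \<Longrightarrow>
      tensor_apply A1 A2 A3 T a b c = unit_tensor r a b c"
    using assms unfolding restricts_to_unit_def by blast
  have "tensor_apply A3 A2 A1 (\<lambda>k j i. T i j k) c b a = tensor_apply A1 A2 A3 T a b c" for a b c
  proof -
    have "tensor_apply A3 A2 A1 (\<lambda>k j i. T i j k) c b a =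
      (\<Sum>k<dim_col A3. \<Sum>i<dim_col A1. \<Sum>j<dim_col A2.
        A3 $$ (c, k) * A2 $$ (b, j) * A1 $$ (a, i) * T i j k)"
      unfolding tensor_apply_def by (intro sum.cong refl sum.swap)
    also have "\<dots> = (\<Sum>i<dim_col A1. \<Sum>k<dim_col A3. \<Sum>j<dim_col A2.
        A3 $$ (c, k) * A2 $$ (b, j) * A1 $$ (a, i) * T i j k)"
      by (rule sum.swap)
    also have "\<dots> = (\<Sum>i<dim_col A1. \<Sum>j<dim_col A2. \<Sum>k<dim_col A3.
        A3 $$ (c, k) * A2 $$ (b, j) * A1 $$ (a, i) * T i j k)"
      by (intro sum.cong refl sum.swap)
    finally show ?thesis unfolding tensor_apply_def by (simp add: mult_ac)
  qed
  \<comment> \<open>The first factor now takes \<open>A3\<close> and the third takes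
    \<open>A1\<close>.\<close>
  then have "restricts_to_unit n3 n2 n1 (\<lambda>k j i. T i j k) r"
    unfolding restricts_to_unit_def using A eq
    by (intro bexI[of _ A1] bexI[of _ A2] bexI[of _ A3]) (auto simp: unit_tensor_entry)
  then show ?thesis by (rule restricts_to_unit_le)
qed

lemma concise_restricts_to_unit_2:
  fixes T :: "'a::field tensor3"
  assumes "n1 > 2" and "n2 > 2" and "concise n1 n2 2 T"
  shows "restricts_to_unit n1 n2 2 T 2"
proof (rule ccontr)
  let ?\<beta> = "contract n1 n2 T"
  assume "\<not> restricts_to_unit n1 n2 2 T 2"
  then have no_unit: "cross (?\<beta> u v') (?\<beta> u' v) = 0"
    if "?\<beta> u v 0 = 0" "?\<beta> u v 1 = 0" for u v u' v'
    using restricts_to_unit_2_of_zero that by blast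
  have rank: "vec_space.rank n1 (flattening1 n1 n2 2 T) = n1"
    "vec_space.rank n2 (flattening2 n1 n2 2 T) = n2"
    "vec_space.rank 2 (flattening3 n1 n2 2 T) = 2"
    using assms(3) by (auto simp: concise_def)
  have left: "cross (?\<beta> u v) (?\<beta> u v') = 0" for u v v'
  proof (rule contract_parallel[OF \<open>n2 > 2\<close> _ no_unit])
    show "\<forall>j<n2. k j = 0"
      if "\<And>i c. i < n1 \<Longrightarrow> c < 2 \<Longrightarrow> (\<Sum>j<n2. k j * T i j c) = 0" for k
      using that by (rule concise_nondegenerate2[OF rank(2)])
  qed
  have right: "cross (?\<beta> u v) (?\<beta> u' v) = 0" for u u' v
  proof -
    have "cross (contract n2 n1 (transpose_tensor T) v u) (contract n2 n1 (transpose_tensor T) v u') = 0"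
    proof (rule contract_parallel[OF \<open>n1 > 2\<close>])
      show "\<forall>i<n1. k i = 0"
        if "\<And>j c. j < n2 \<Longrightarrow> c < 2 \<Longrightarrow> (\<Sum>i<n1. k i * transpose_tensor T j i c) = 0" for k
        using that by (intro concise_nondegenerate1[OF rank(1)]) (simp add: transpose_tensor_def)
    next
      fix v u v' u' :: "nat \<Rightarrow> 'a"
      assume "contract n2 n1 (transpose_tensor T) v u 0 = 0" "contract n2 n1 (transpose_tensor T) v u 1 = 0"
      then have "cross (?\<beta> u v') (?\<beta> u' v) = 0" by (intro no_unit) (simp_all add: contract_transpose)
      \<comment> \<open>Transposing swaps the two arguments of \<open>cross\<close>, which changes
        only its sign.\<close>
      then show "cross (contract n2 n1 (transpose_tensor T) v u') (contract n2 n1 (transpose_tensor T) v' u) = 0"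
        by (simp add: contract_transpose cross_def mult.commute)
    qed
    then show ?thesis by (simp add: contract_transpose)
  qed
  obtain i j i' j' where ij: "i < n1" "j < n2" "i' < n1" "j' < n2" "cross (T i j) (T i' j') \<noteq> 0"
    using concise_nonzero_minor[OF rank(3)] .
  define e :: "nat \<Rightarrow> nat \<Rightarrow> 'a" where "e a = (\<lambda>b. if b = a then 1 else 0)" for a
  have indep: "cross (?\<beta> (e i) (e j)) (?\<beta> (e i') (e j')) \<noteq> 0"
    using ij by (simp add: e_def contract_unit_unit cross_def)
  \<comment> \<open>If this vector were nonzero, \<open>cross_trans\<close> through it would make
    the two independent values in \<open>indep\<close> parallel.\<close>
  have "?\<beta> (e i) (e j') 0 = 0" "?\<beta> (e i) (e j') 1 = 0"
    using cross_trans[OF left[of "e i" "e j" "e j'"] right[of "e i'" "e j'" "e i"]] indep by blast+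
  then show False using no_unit indep by blast
qed

theorem theorem3p19:
  fixes n1 n2 :: nat and T :: "'a::field tensor3"
  assumes "n1 > 2" and "n2 > 2"
    and "concise n1 n2 2 T"
  shows "subrank n1 n2 2 T = 2"
  using le_subrank[OF concise_restricts_to_unit_2[OF assms]]
    restricts_to_unit_le3[OF restricts_to_unit_subrank] by (rule antisym[rotated])

end
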